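(* (a) For every $k\in\mathbb{N}$ there exists a spherical $k$-slant curve in $\mathbb{R}^3$. (b) For every $k\in\mathbb{N}$, every spherical $k$-slant curve with axis $\vec u=(0,0,1)$ is, up to reparametrization, of the form $I^{k+1}(\gamma)(\cdot,\theta_0,\dots,\theta_k)$ for some constants $\theta_0,\dots,\theta_k\in\mathbb{R}$ and some circle $\gamma(s)=(r\cos(s/r),\,r\sin(s/r),\,a)$ with $r>0$, $a\in\mathbb{R}$, $a^2+r^2=1$, where $s$ ranges over an open interval. (c) For every $k\in\mathbb{N}$, every spherical $k$-slant curve is, up to reparametrization, of the form $I^{k+1}(\gamma)(\cdot,\theta_0,\dots,\theta_k)$ for some constants $\theta_0,\dots,\theta_k$ and some constant-speed parametrization $\gamma$ (on an open interval) of a circle lying on the unit sphere.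
   Context: A spherical curve is a smooth regular curve defined on an open interval and lying on the unit sphere $S^2\subset\mathbb{R}^3$ centred at the origin. $k$-slant curves: for a regular curve $\alpha$ put $\psi_1=\alpha'/\|\alpha'\|$ and $\psi_{j+1}=\psi_j'/\|\psi_j'\|$ for $j\ge1$ (as long as $\psi_j'$ never vanishes). The curve $\alpha$ is $k$-slant with axis the fixed nonzero vector $\vec u$ if $\psi_1,\dots,\psi_{k+1}$ are defined and $\psi_{k+1}$ makes a constant angle with $\vec u$; it is $k$-slant if it is $k$-slant with some axis. ($0$-slant curves are general helices, $1$-slant curves are slant helices.) The operator $I$: for a regular curve $\gamma:J\to S^2$ on an open interval $J$ (which may be assumed to contain $0$) and $\theta_0\in\mathbb{R}$ put $$S_\gamma(t,\theta_0)=\|\gamma'(t)\|\cos\left(\int_0^t\frac{\det(\gamma(u),\gamma'(u),\gamma''(u))}{\|\gamma'(u)\|^2}du+\theta_0\right),$$ and let $I(\gamma)(t,\theta_0)=\int S_\gamma(t,\theta_0)\gamma(t)\,dt$ denote an antiderivative of $t\mapsto S_\gamma(t,\theta_0)\gamma(t)$, with the constant of integration chosen so that it takes values in $S^2$ (such a choice exists). Whenever the curves obtained are regular, iterates are defined by $I^1(\gamma)=I(\gamma)$ and $I^{n+1}(\gamma)(\cdot,\theta_0,\dots,\theta_n)=I\big(I^{n}(\gamma)(\cdot,\theta_0,\dots,\theta_{n-1})\big)(\cdot,\theta_n)$. *)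

theory Defs
  imports "HOL-Analysis.Analysis"
begin

section \<open>Regular curves on intervals\<close>

definition open_interval :: "real set \<Rightarrow> bool" where
  "open_interval J \<longleftrightarrow> open J \<and> is_interval J \<and> J \<noteq> {}"

abbreviation vderiv :: "(real \<Rightarrow> 'a::real_normed_vector) \<Rightarrow> real \<Rightarrow> 'a" where
  "vderiv f \<equiv> (\<lambda>t. vector_derivative f (at t))"

text \<open>Smoothness of class \<open>C\<^sup>\<infinity>\<close>. The definition is meant for open \<open>J\<close> only; there the iterated
  derivatives at points of \<open>J\<close> depend on the values of \<open>f\<close> on \<open>J\<close> alone.\<close>

definition smooth_on :: "real set \<Rightarrow> (real \<Rightarrow> 'a::real_normed_vector) \<Rightarrow> bool" where
  "smooth_on J f \<longleftrightarrow> (\<forall>n. (vderiv ^^ n) f differentiable_on J)"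

definition regular_curve :: "real set \<Rightarrow> (real \<Rightarrow> real^3) \<Rightarrow> bool" where
  "regular_curve J \<alpha> \<longleftrightarrow> open_interval J \<and> smooth_on J \<alpha> \<and> (\<forall>t\<in>J. vderiv \<alpha> t \<noteq> 0)"

definition spherical_curve :: "real set \<Rightarrow> (real \<Rightarrow> real^3) \<Rightarrow> bool" where
  "spherical_curve J \<alpha> \<longleftrightarrow> regular_curve J \<alpha> \<and> \<alpha> ` J \<subseteq> sphere 0 1"

text \<open>\<open>\<alpha>\<close> on \<open>J\<close> is \<open>\<beta>\<close> on \<open>J'\<close> composed with a diffeomorphism \<open>\<phi>\<close>, which may reverse the
  orientation.\<close>

definition reparametrization ::
    "real set \<Rightarrow> (real \<Rightarrow> real^3) \<Rightarrow> real set \<Rightarrow> (real \<Rightarrow> real^3) \<Rightarrow> bool" where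
  "reparametrization J \<alpha> J' \<beta> \<longleftrightarrow>
     (\<exists>\<phi>::real \<Rightarrow> real. smooth_on J \<phi> \<and> (\<forall>t\<in>J. vderiv \<phi> t \<noteq> 0) \<and> bij_betw \<phi> J J' \<and>
        (\<forall>t\<in>J. \<alpha> t = \<beta> (\<phi> t)))"

section \<open>\<open>k\<close>-slant curves\<close>

text \<open>\<open>psi \<alpha> j\<close> is \<open>\<psi>\<^sub>j\<close> for \<open>j \<ge> 1\<close>. Starting the recursion with \<open>\<psi>\<^sub>0 = \<alpha>\<close> yields
  \<open>\<psi>\<^sub>1 = \<alpha>' / \<parallel>\<alpha>'\<parallel>\<close>.\<close>

primrec psi :: "(real \<Rightarrow> real^3) \<Rightarrow> nat \<Rightarrow> real \<Rightarrow> real^3" where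
  "psi \<alpha> 0 = \<alpha>"
| "psi \<alpha> (Suc j) = (\<lambda>t. vderiv (psi \<alpha> j) t /\<^sub>R norm (vderiv (psi \<alpha> j) t))"

definition vec_angle :: "real^3 \<Rightarrow> real^3 \<Rightarrow> real" where
  "vec_angle v w = arccos (v \<bullet> w / (norm v * norm w))"

text \<open>The nonvanishing condition for \<open>j = 1, \<dots>, k\<close> says that
  \<open>\<psi>\<^sub>2, \<dots>, \<psi>\<^sub>k\<^sub>+\<^sub>1\<close> are defined; for \<open>\<psi>\<^sub>1\<close> this is the regularity of \<open>\<alpha>\<close>.\<close>

definition k_slant_with_axis ::
    "nat \<Rightarrow> real set \<Rightarrow> (real \<Rightarrow> real^3) \<Rightarrow> real^3 \<Rightarrow> bool" where
  "k_slant_with_axis k J \<alpha> u \<longleftrightarrow>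
     u \<noteq> 0 \<and> regular_curve J \<alpha> \<and>
     (\<forall>j\<in>{1..k}. \<forall>t\<in>J. vderiv (psi \<alpha> j) t \<noteq> 0) \<and>
     (\<exists>\<omega>. \<forall>t\<in>J. vec_angle (psi \<alpha> (Suc k) t) u = \<omega>)"

definition k_slant :: "nat \<Rightarrow> real set \<Rightarrow> (real \<Rightarrow> real^3) \<Rightarrow> bool" where
  "k_slant k J \<alpha> \<longleftrightarrow> (\<exists>u. k_slant_with_axis k J \<alpha> u)"

section \<open>The operator \<open>I\<close>\<close>

text \<open>The interval integral is oriented, so \<open>t < 0\<close> is covered.\<close>

definition S_fun :: "(real \<Rightarrow> real^3) \<Rightarrow> real \<Rightarrow> real \<Rightarrow> real" where
  "S_fun \<gamma> \<theta> t =
     norm (vderiv \<gamma> t) *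
     cos ((LBINT u=0..t. det (vector [\<gamma> u, vderiv \<gamma> u, vderiv (vderiv \<gamma>) u] :: real^3^3)
                          / (norm (vderiv \<gamma> u))\<^sup>2) + \<theta>)"

text \<open>\<open>\<beta>\<close> is a version of \<open>I(\<gamma>)(\<cdot>, \<theta>)\<close>: an antiderivative of \<open>S\<^sub>\<gamma>(\<cdot>, \<theta>) \<gamma>\<close> on \<open>J\<close> with
  values in the unit sphere. This is a relation because the constant of integration need not be
  unique: for a great circle \<open>\<gamma>\<close> there are in general two admissible choices.\<close>

definition is_I :: "real set \<Rightarrow> (real \<Rightarrow> real^3) \<Rightarrow> real \<Rightarrow> (real \<Rightarrow> real^3) \<Rightarrow> bool" where
  "is_I J \<gamma> \<theta> \<beta> \<longleftrightarrow>
     0 \<in> J \<and> spherical_curve J \<gamma> \<and>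
     (\<forall>t\<in>J. (\<beta> has_vector_derivative S_fun \<gamma> \<theta> t *\<^sub>R \<gamma> t) (at t)) \<and>
     \<beta> ` J \<subseteq> sphere 0 1"

text \<open>\<open>\<beta>\<close> is a version of \<open>I\<^sup>n(\<gamma>)(\<cdot>, \<theta>\<^sub>0, \<dots>, \<theta>\<^sub>n\<^sub>-\<^sub>1)\<close>, with \<open>I\<^sup>0(\<gamma>) = \<gamma>\<close>. Each curve to which
  \<open>I\<close> is applied is regular by \<open>is_I\<close>.\<close>

primrec is_I_iter ::
    "nat \<Rightarrow> real set \<Rightarrow> (real \<Rightarrow> real^3) \<Rightarrow> (nat \<Rightarrow> real) \<Rightarrow> (real \<Rightarrow> real^3) \<Rightarrow> bool" where
  "is_I_iter 0 J \<gamma> \<theta> \<beta> \<longleftrightarrow> \<beta> = \<gamma>"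
| "is_I_iter (Suc n) J \<gamma> \<theta> \<beta> \<longleftrightarrow> (\<exists>\<delta>. is_I_iter n J \<gamma> \<theta> \<delta> \<and> is_I J \<delta> (\<theta> n) \<beta>)"

section \<open>Circles\<close>

definition std_circle :: "real \<Rightarrow> real \<Rightarrow> real \<Rightarrow> real^3" where
  "std_circle r a s = vector [r * cos (s / r), r * sin (s / r), a]"

definition is_circle :: "(real^3) set \<Rightarrow> bool" where
  "is_circle C \<longleftrightarrow> (\<exists>p u r. u \<noteq> 0 \<and> r > 0 \<and> C = {x. (x - p) \<bullet> u = 0 \<and> dist p x = r})"

text \<open>The curve need not run through all of the circle, since \<open>J\<close> may be short.\<close>

definition const_speed_spherical_circle :: "real set \<Rightarrow> (real \<Rightarrow> real^3) \<Rightarrow> bool" where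
  "const_speed_spherical_circle J \<gamma> \<longleftrightarrow>
     regular_curve J \<gamma> \<and>
     (\<exists>C. is_circle C \<and> C \<subseteq> sphere 0 1 \<and> \<gamma> ` J \<subseteq> C) \<and>
     (\<exists>v. \<forall>t\<in>J. norm (vderiv \<gamma> t) = v)"

text \<open>\<open>I\<close> needs \<open>0\<close> in the parameter interval. For a curve \<open>\<gamma>\<close> on an arbitrary open interval \<open>K\<close>
  this is arranged by moving some \<open>c \<in> K\<close> to \<open>0\<close>, that is, by passing to \<open>shift_curve c \<gamma>\<close> on
  \<open>shift_interval c K\<close>.\<close>

definition shift_interval :: "real \<Rightarrow> real set \<Rightarrow> real set" where
  "shift_interval c K = (\<lambda>s. s - c) ` K"

definition shift_curve :: "real \<Rightarrow> (real \<Rightarrow> real^3) \<Rightarrow> real \<Rightarrow> real^3" where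
  "shift_curve c \<gamma> = (\<lambda>t. \<gamma> (t + c))"

end

theory Submission
  imports Defs
begin

text \<open>For a spherical curve all \<open>\<psi>\<^sub>j\<close> exist and are regular spherical curves, since
  \<open>\<psi>\<^sub>j \<bullet> \<psi>\<^sub>j\<^sub>+\<^sub>1' = - \<parallel>\<psi>\<^sub>j'\<parallel>\<close> (\<open>spherical_curve_psi\<close>). Being \<open>k\<close>-slant therefore means that
  \<open>\<psi>\<^sub>k\<^sub>+\<^sub>1\<close> stays on a circle on the sphere (\<open>k_slant_psi_on_circle\<close>).

  Passing to the unit tangent is undone by \<open>I\<close>: if a curve \<open>\<beta>\<close> on the sphere has a derivative
  that is a nowhere vanishing multiple of a spherical curve \<open>\<gamma>\<close>, then \<open>\<beta>\<close> is a version of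
  \<open>I(\<gamma>)(\<cdot>, \<theta>)\<close> for some \<open>\<theta>\<close>. Indeed \<open>\<beta>\<close> is orthogonal to \<open>\<gamma>\<close>, and its two
  components in the frame of tangent and conormal of \<open>\<gamma>\<close> rotate with the angular velocity that is
  integrated in \<open>S\<^sub>\<gamma>\<close>; the constant \<open>\<theta>\<close> is the initial angle
  (\<open>is_I_if_derivative_parallel\<close>).

  Now let \<open>\<phi>\<close> be a diffeomorphism that carries \<open>\<psi>\<^sub>k\<^sub>+\<^sub>1\<close> to a parametrization \<open>\<gamma>\<close> of its circle.
  Transporting \<open>\<psi>\<^sub>k, \<dots>, \<psi>\<^sub>1, \<psi>\<^sub>0 = \<alpha>\<close> along \<open>\<phi>\<close> yields curves each of which has its derivative
  parallel to the preceding one, so \<open>\<alpha>\<close> becomes \<open>I\<^sup>k\<^sup>+\<^sup>1(\<gamma>)\<close> (\<open>iterated_I_of_psi\<close>). For an axis in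
  general position \<open>\<phi>\<close> is the arc length of \<open>\<psi>\<^sub>k\<^sub>+\<^sub>1\<close>; for the vertical axis it is the radius
  times the polar angle, which produces the standard circle. Existence is seen on a great circle,
  whose \<open>\<psi>\<^sub>j\<close> never leave its plane.\<close>

section \<open>Smooth maps on open subsets of the line\<close>

text \<open>Smoothness is graded by the order of differentiability, because the closure properties below
  are proved by induction on the order: the derivative of a product, a reciprocal, a composition
  or an inverse function is an expression in the given functions and in the new function itself,
  the latter being needed only to one order less. The derivative is quantified existentially, so
  that any formula for it on \<open>J\<close> can serve as a witness, whatever its values outside \<open>J\<close>.\<close>

primrec times_differentiable :: "nat \<Rightarrow> real set \<Rightarrow> (real \<Rightarrow> 'a::real_normed_vector) \<Rightarrow> bool" where
  "times_differentiable 0 J f \<longleftrightarrow> True"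
| "times_differentiable (Suc n) J f \<longleftrightarrow>
     (\<exists>f'. (\<forall>t\<in>J. (f has_vector_derivative f' t) (at t)) \<and> times_differentiable n J f')"

lemma times_differentiable_SucI:
  assumes "\<And>t. t \<in> J \<Longrightarrow> (f has_vector_derivative f' t) (at t)" "times_differentiable n J f'"
  shows "times_differentiable (Suc n) J f"
  unfolding times_differentiable.simps by (intro exI[of _ f'] conjI ballI assms)

lemma times_differentiable_cong:
  assumes "open J" "\<And>t. t \<in> J \<Longrightarrow> f t = g t" "times_differentiable n J f"
  shows "times_differentiable n J g"
proof (cases n)
  case (Suc m)
  with assms(3) obtain f' where f': "\<And>t. t \<in> J \<Longrightarrow> (f has_vector_derivative f' t) (at t)"
      "times_differentiable m J f'"
    by auto
  have "(g has_vector_derivative f' t) (at t)" if "t \<in> J" for t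
    using has_vector_derivative_transform_within_open[OF f'(1)[OF that] assms(1) that assms(2)] .
  with f'(2) Suc show ?thesis
    by auto
qed simp

lemma times_differentiable_mono:
  "times_differentiable (Suc n) J f \<Longrightarrow> times_differentiable n J f"
proof (induction n arbitrary: f)
  case (Suc n)
  obtain f' where f': "\<And>t. t \<in> J \<Longrightarrow> (f has_vector_derivative f' t) (at t)"
      "times_differentiable (Suc n) J f'"
    using iffD1[OF times_differentiable.simps(2) Suc.prems] by blast
  show ?case
    using f'(1) Suc.IH[OF f'(2)] by (rule times_differentiable_SucI)
qed simp

text \<open>The link to the iterated derivatives in \<^const>\<open>smooth_on\<close>. Openness of \<open>J\<close> makes
  \<^const>\<open>vector_derivative\<close> at a point of \<open>J\<close> depend on the values on \<open>J\<close> only, so that a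
  witness may be replaced by the canonical derivative.\<close>

lemma times_differentiable_iff_vderiv:
  assumes "open J"
  shows "times_differentiable n J f \<longleftrightarrow> (\<forall>m<n. (vderiv ^^ m) f differentiable_on J)"
proof (induction n arbitrary: f)
  case (Suc n)
  have step: "times_differentiable (Suc n) J f \<longleftrightarrow>
      f differentiable_on J \<and> times_differentiable n J (vderiv f)" (is "_ \<longleftrightarrow> ?R")
  proof
    assume "times_differentiable (Suc n) J f"
    then obtain f' where f': "\<And>t. t \<in> J \<Longrightarrow> (f has_vector_derivative f' t) (at t)"
        "times_differentiable n J f'"
      by auto
    have "f differentiable_on J"
      using f'(1) assms
      by (meson differentiableI_vector differentiable_at_imp_differentiable_on)
    moreover have "times_differentiable n J (vderiv f)"
      by (rule times_differentiable_cong[OF assms _ f'(2)])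
        (simp add: vector_derivative_at[OF f'(1)])
    ultimately show ?R ..
  next
    assume ?R
    then have "(f has_vector_derivative vderiv f t) (at t)" if "t \<in> J" for t
      using assms that
      by (simp add: differentiable_on_eq_differentiable_at vector_derivative_works)
    then show "times_differentiable (Suc n) J f"
      using \<open>?R\<close> by (intro times_differentiable_SucI[where f' = "vderiv f"]) auto
  qed
  have "(\<forall>m<Suc n. (vderiv ^^ m) f differentiable_on J) \<longleftrightarrow>
      f differentiable_on J \<and> (\<forall>m<n. (vderiv ^^ m) (vderiv f) differentiable_on J)"
    unfolding All_less_Suc2 funpow_Suc_right o_apply by simp
  then show ?case
    unfolding step Suc.IH by simp
qed simp

lemma smooth_on_iff_times_differentiable:
  assumes "open J"
  shows "smooth_on J f \<longleftrightarrow> (\<forall>n. times_differentiable n J f)"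
  unfolding smooth_on_def times_differentiable_iff_vderiv[OF assms] by blast

lemma smooth_on_has_vector_derivative:
  assumes "open J" "smooth_on J f" "t \<in> J"
  shows "(f has_vector_derivative vderiv f t) (at t)"
proof -
  have "f differentiable_on J"
    using assms(2) unfolding smooth_on_def by (metis funpow_0)
  then show ?thesis
    using assms(1,3) by (simp add: differentiable_on_eq_differentiable_at vector_derivative_works)
qed

lemma smooth_on_vderiv: "smooth_on J f \<Longrightarrow> smooth_on J (vderiv f)"
  unfolding smooth_on_def by (metis funpow_Suc_right o_apply)

lemma smooth_on_continuous_on: "smooth_on J f \<Longrightarrow> continuous_on J f"
  unfolding smooth_on_def by (metis differentiable_imp_continuous_on funpow_0)

lemma smooth_on_if_derivative_smooth:
  assumes "open J" "\<And>t. t \<in> J \<Longrightarrow> (f has_vector_derivative f' t) (at t)" "smooth_on J f'"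
  shows "smooth_on J f"
  unfolding smooth_on_iff_times_differentiable[OF assms(1)]
proof
  fix n
  show "times_differentiable n J f"
  proof (cases n)
    case (Suc m)
    then show ?thesis
      using assms by (auto simp: smooth_on_iff_times_differentiable)
  qed simp
qed

lemma times_differentiable_add:
  "times_differentiable n J f \<Longrightarrow> times_differentiable n J g \<Longrightarrow>
    times_differentiable n J (\<lambda>t. f t + g t)"
proof (induction n arbitrary: f g)
  case (Suc n)
  obtain f' where f': "\<And>t. t \<in> J \<Longrightarrow> (f has_vector_derivative f' t) (at t)"
      "times_differentiable n J f'"
    using Suc.prems(1) by auto
  obtain g' where g': "\<And>t. t \<in> J \<Longrightarrow> (g has_vector_derivative g' t) (at t)"
      "times_differentiable n J g'"
    using Suc.prems(2) by auto
  show ?case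
    by (rule times_differentiable_SucI[OF _ Suc.IH[OF f'(2) g'(2)]])
      (intro has_vector_derivative_add f'(1) g'(1))
qed simp

lemma (in bounded_linear) times_differentiable:
  "times_differentiable n J g \<Longrightarrow> times_differentiable n J (\<lambda>t. f (g t))"
proof (induction n arbitrary: g)
  case (Suc n)
  obtain g' where g': "\<And>t. t \<in> J \<Longrightarrow> (g has_vector_derivative g' t) (at t)"
      "times_differentiable n J g'"
    using Suc.prems by auto
  show ?case
    by (rule times_differentiable_SucI[OF _ Suc.IH[OF g'(2)]])
      (intro has_vector_derivative g'(1))
qed simp

lemma (in bounded_bilinear) times_differentiable:
  "times_differentiable n J f \<Longrightarrow> times_differentiable n J g \<Longrightarrow>
    times_differentiable n J (\<lambda>t. prod (f t) (g t))"
proof (induction n arbitrary: f g)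
  case (Suc n)
  obtain f' where f': "\<And>t. t \<in> J \<Longrightarrow> (f has_vector_derivative f' t) (at t)"
      "times_differentiable n J f'"
    using Suc.prems(1) by auto
  obtain g' where g': "\<And>t. t \<in> J \<Longrightarrow> (g has_vector_derivative g' t) (at t)"
      "times_differentiable n J g'"
    using Suc.prems(2) by auto
  have "times_differentiable n J f" "times_differentiable n J g"
    using Suc.prems times_differentiable_mono by blast+
  then have "times_differentiable n J (\<lambda>t. prod (f t) (g' t) + prod (f' t) (g t))"
    by (intro times_differentiable_add Suc.IH f'(2) g'(2))
  then show ?case
    by (rule times_differentiable_SucI[rotated]) (intro has_vector_derivative f'(1) g'(1))
qed simp

lemma times_differentiable_inverse:
  fixes f :: "real \<Rightarrow> real"
  assumes "\<And>t. t \<in> J \<Longrightarrow> f t \<noteq> 0"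
  shows "times_differentiable n J f \<Longrightarrow> times_differentiable n J (\<lambda>t. inverse (f t))"
proof (induction n)
  case (Suc n)
  obtain f' where f': "\<And>t. t \<in> J \<Longrightarrow> (f has_vector_derivative f' t) (at t)"
      "times_differentiable n J f'"
    using Suc.prems by auto
  have IH: "times_differentiable n J (\<lambda>t. inverse (f t))"
    using Suc times_differentiable_mono by blast
  have "times_differentiable n J (\<lambda>t. - (f' t * (inverse (f t) * inverse (f t))))"
    by (intro bounded_linear.times_differentiable[OF bounded_linear_minus[OF bounded_linear_ident]]
        bounded_bilinear.times_differentiable[OF bounded_bilinear_mult] IH f'(2))
  then show ?case
  proof (rule times_differentiable_SucI[rotated])
    fix t assume t: "t \<in> J"
    have "(f has_field_derivative f' t) (at t)"
      using f'(1)[OF t] by (simp add: has_real_derivative_iff_has_vector_derivative)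
    from DERIV_inverse_fun[OF this assms[OF t]]
    show "((\<lambda>t. inverse (f t)) has_vector_derivative - (f' t * (inverse (f t) * inverse (f t)))) (at t)"
      by (simp add: has_real_derivative_iff_has_vector_derivative power2_eq_square mult.assoc)
  qed
qed simp

lemma times_differentiable_norm:
  fixes f :: "real \<Rightarrow> 'a::real_inner"
  assumes "\<And>t. t \<in> J \<Longrightarrow> f t \<noteq> 0"
  shows "times_differentiable n J f \<Longrightarrow> times_differentiable n J (\<lambda>t. norm (f t))"
proof (induction n)
  case (Suc n)
  obtain f' where f': "\<And>t. t \<in> J \<Longrightarrow> (f has_vector_derivative f' t) (at t)"
      "times_differentiable n J f'"
    using Suc.prems by auto
  have fn: "times_differentiable n J f"
    using Suc.prems times_differentiable_mono by blast
  have "times_differentiable n J (\<lambda>t. (f' t \<bullet> f t) * inverse (norm (f t)))"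
    by (intro bounded_bilinear.times_differentiable[OF bounded_bilinear_mult]
        bounded_bilinear.times_differentiable[OF bounded_bilinear_inner]
        times_differentiable_inverse f'(2) fn Suc.IH) (use assms in auto)
  then show ?case
  proof (rule times_differentiable_SucI[rotated])
    fix t assume t: "t \<in> J"
    have "((\<lambda>t. norm (f t)) has_derivative (\<lambda>h. (h *\<^sub>R f' t) \<bullet> sgn (f t))) (at t)"
      using has_derivative_compose[OF f'(1)[OF t, unfolded has_vector_derivative_def]
          has_derivative_norm[OF assms[OF t]]] by simp
    then show "((\<lambda>t. norm (f t)) has_vector_derivative (f' t \<bullet> f t) * inverse (norm (f t))) (at t)"
      unfolding has_vector_derivative_def by (simp add: sgn_div_norm mult_ac)
  qed
qed simp

lemma times_differentiable_compose:
  assumes "\<And>s. s \<in> K \<Longrightarrow> \<phi> s \<in> J"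
  shows "times_differentiable n J f \<Longrightarrow> times_differentiable n K \<phi> \<Longrightarrow>
    times_differentiable n K (\<lambda>s. f (\<phi> s))"
proof (induction n arbitrary: f)
  case (Suc n)
  obtain f' where f': "\<And>t. t \<in> J \<Longrightarrow> (f has_vector_derivative f' t) (at t)"
      "times_differentiable n J f'"
    using Suc.prems(1) by auto
  obtain \<phi>' where \<phi>': "\<And>s. s \<in> K \<Longrightarrow> (\<phi> has_vector_derivative \<phi>' s) (at s)"
      "times_differentiable n K \<phi>'"
    using Suc.prems(2) by auto
  have "times_differentiable n K (\<lambda>s. f' (\<phi> s))"
    using Suc.IH[OF f'(2)] Suc.prems(2) times_differentiable_mono by blast
  then have "times_differentiable n K (\<lambda>s. \<phi>' s *\<^sub>R f' (\<phi> s))"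
    by (intro bounded_bilinear.times_differentiable[OF bounded_bilinear_scaleR] \<phi>'(2))
  then show ?case
  proof (rule times_differentiable_SucI[rotated])
    fix s assume "s \<in> K"
    then show "((\<lambda>s. f (\<phi> s)) has_vector_derivative \<phi>' s *\<^sub>R f' (\<phi> s)) (at s)"
      using vector_diff_chain_at[OF \<phi>'(1) f'(1)] assms by (simp add: o_def)
  qed
qed simp

lemma (in bounded_linear) smooth_on:
  assumes "open J" "smooth_on J g"
  shows "smooth_on J (\<lambda>t. f (g t))"
  using assms(2) unfolding smooth_on_iff_times_differentiable[OF assms(1)]
  by (blast intro: times_differentiable)

lemma (in bounded_bilinear) smooth_on:
  assumes "open J" "smooth_on J f" "smooth_on J g"
  shows "smooth_on J (\<lambda>t. prod (f t) (g t))"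
  using assms(2,3) unfolding smooth_on_iff_times_differentiable[OF assms(1)]
  by (blast intro: times_differentiable)

lemmas smooth_on_scaleR = bounded_bilinear.smooth_on[OF bounded_bilinear_scaleR]

lemma smooth_on_inverse:
  fixes f :: "real \<Rightarrow> real"
  assumes "open J" "smooth_on J f" "\<And>t. t \<in> J \<Longrightarrow> f t \<noteq> 0"
  shows "smooth_on J (\<lambda>t. inverse (f t))"
  using assms(2,3) unfolding smooth_on_iff_times_differentiable[OF assms(1)]
  by (blast intro: times_differentiable_inverse)

lemma smooth_on_norm:
  fixes f :: "real \<Rightarrow> 'a::real_inner"
  assumes "open J" "smooth_on J f" "\<And>t. t \<in> J \<Longrightarrow> f t \<noteq> 0"
  shows "smooth_on J (\<lambda>t. norm (f t))"
  using assms(2,3) unfolding smooth_on_iff_times_differentiable[OF assms(1)]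
  by (blast intro: times_differentiable_norm)

lemma smooth_on_compose:
  assumes "open J" "open K" "\<And>s. s \<in> K \<Longrightarrow> \<phi> s \<in> J" "smooth_on J f" "smooth_on K \<phi>"
  shows "smooth_on K (\<lambda>s. f (\<phi> s))"
  using assms(3-5) unfolding smooth_on_iff_times_differentiable[OF assms(1)]
    smooth_on_iff_times_differentiable[OF assms(2)]
  by (blast intro: times_differentiable_compose)

text \<open>A class of functions that is closed under differentiation consists of smooth functions. This
  suits functions given by explicit formulas such as trigonometric polynomials.\<close>

lemma smooth_on_coinduct:
  assumes "open J" "P f"
    and "\<And>g. P g \<Longrightarrow> \<exists>g'. P g' \<and> (\<forall>t\<in>J. (g has_vector_derivative g' t) (at t))"
  shows "smooth_on J f"
proof -
  have "times_differentiable n J g" if "P g" for n g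
    using that
  proof (induction n arbitrary: g)
    case (Suc n)
    then show ?case
      using assms(3)[OF Suc.prems] by auto
  qed simp
  with assms(1,2) show ?thesis
    by (simp add: smooth_on_iff_times_differentiable)
qed

section \<open>Calculus on open intervals\<close>

lemma open_intervalD:
  assumes "open_interval J"
  shows "open J" "is_interval J" "convex J" "J \<noteq> {}"
  using assms by (auto simp: open_interval_def is_interval_convex)

lemma open_interval_atLeastAtMost_subset:
  assumes "open_interval J" "a \<in> J" "b \<in> J"
  shows "{a..b} \<subseteq> J"
  using mem_is_interval_1_I[OF open_intervalD(2)[OF assms(1)] assms(2,3)] by auto

lemma eq_if_zero_derivative:
  assumes "open_interval J" "\<And>t. t \<in> J \<Longrightarrow> (f has_vector_derivative 0) (at t)" "s \<in> J" "t \<in> J"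
  shows "f s = f t"
proof -
  obtain c where "\<And>x. x \<in> J \<Longrightarrow> f x = c"
    using has_vector_derivative_zero_constant[OF open_intervalD(3)[OF assms(1)]]
      has_vector_derivative_at_within[OF assms(2)] by blast
  with assms(3,4) show ?thesis
    by simp
qed

lemma has_vector_derivative_integral:
  fixes f :: "real \<Rightarrow> real"
  assumes "open_interval J" "c \<in> J" "continuous_on J f" "t \<in> J"
  shows "((\<lambda>u. LBINT y=c..u. f y) has_vector_derivative f t) (at t)"
proof -
  obtain e where e: "e > 0" "ball c e \<subseteq> J" "ball t e \<subseteq> J"
  proof -
    obtain e1 e2 where "e1 > 0" "ball c e1 \<subseteq> J" "e2 > 0" "ball t e2 \<subseteq> J"
      using open_intervalD(1)[OF assms(1)] assms(2,4) by (meson open_contains_ball)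
    then show thesis
      by (intro that[of "min e1 e2"]) auto
  qed
  define a b where "a = min c t - e / 2" and "b = max c t + e / 2"
  have "a \<in> ball c e \<union> ball t e" "b \<in> ball c e \<union> ball t e"
    using \<open>e > 0\<close> by (auto simp: a_def b_def min_def max_def dist_real_def)
  with e have "a \<in> J" "b \<in> J"
    by blast+
  then have sub: "{a..b} \<subseteq> J"
    by (rule open_interval_atLeastAtMost_subset[OF assms(1)])
  have ab: "a < c" "c < b" "a < t" "t < b"
    using \<open>e > 0\<close> by (auto simp: a_def b_def)
  have "((\<lambda>u. LBINT y=c..u. f y) has_vector_derivative f t) (at t within {a..b})"
    using ab by (intro interval_integral_FTC2 continuous_on_subset[OF assms(3) sub]) auto
  then show ?thesis
    unfolding at_within_Icc_at[OF ab(3,4)] .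
qed

text \<open>A planar point that rotates about the origin with angular velocity \<open>w\<close> keeps its radius, and
  its polar angle is an antiderivative \<open>\<Theta>\<close> of \<open>w\<close>. The reason is uniqueness for a linear system:
  the squared distance \<open>D\<close> between the two solutions is constant, as rotations are isometries. The
  lemma is used twice, for the components of \<open>I(\<gamma>)\<close> in the moving frame of \<open>\<gamma>\<close> and for the
  polar angle on a horizontal circle.\<close>

lemma rotation_system_solution:
  fixes x y \<Theta> w :: "real \<Rightarrow> real"
  assumes J: "open_interval J" "t\<^sub>0 \<in> J" "t \<in> J"
    and x: "\<And>t. t \<in> J \<Longrightarrow> (x has_vector_derivative - (w t * y t)) (at t)"
    and y: "\<And>t. t \<in> J \<Longrightarrow> (y has_vector_derivative w t * x t) (at t)"
    and \<Theta>: "\<And>t. t \<in> J \<Longrightarrow> (\<Theta> has_vector_derivative w t) (at t)"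
    and init: "x t\<^sub>0 = r * cos (\<Theta> t\<^sub>0)" "y t\<^sub>0 = r * sin (\<Theta> t\<^sub>0)"
  shows "x t = r * cos (\<Theta> t)" "y t = r * sin (\<Theta> t)"
proof -
  define D where "D t = (x t - r * cos (\<Theta> t))\<^sup>2 + (y t - r * sin (\<Theta> t))\<^sup>2" for t
  have "(D has_vector_derivative 0) (at t)" if "t \<in> J" for t
    unfolding D_def has_real_derivative_iff_has_vector_derivative[symmetric]
    by (rule derivative_eq_intros x[OF that, folded has_real_derivative_iff_has_vector_derivative]
        y[OF that, folded has_real_derivative_iff_has_vector_derivative]
        \<Theta>[OF that, folded has_real_derivative_iff_has_vector_derivative] refl)+
      (simp add: algebra_simps)
  then have "D t = D t\<^sub>0"
    by (rule eq_if_zero_derivative[OF J(1) _ J(3,2)])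
  then have "D t = 0"
    by (simp add: D_def init)
  then show "x t = r * cos (\<Theta> t)" "y t = r * sin (\<Theta> t)"
    unfolding D_def sum_power2_eq_zero_iff by simp_all
qed

lemma inj_on_if_derivative_nonzero:
  fixes \<phi> :: "real \<Rightarrow> real"
  assumes J: "open_interval J"
    and \<phi>: "\<And>t. t \<in> J \<Longrightarrow> (\<phi> has_vector_derivative g t) (at t)"
    and g: "\<And>t. t \<in> J \<Longrightarrow> g t \<noteq> 0"
  shows "inj_on \<phi> J"
proof (rule linorder_inj_onI')
  fix a b assume ab: "a \<in> J" "b \<in> J" "a < b"
  have sub: "x \<in> J" if "a \<le> x" "x \<le> b" for x
    using open_interval_atLeastAtMost_subset[OF J ab(1,2)] that by auto
  obtain z where "a < z" "z < b" "\<phi> b - \<phi> a = (b - a) * g z"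
    using MVT2[OF \<open>a < b\<close>, of \<phi> g] \<phi> sub
    by (auto simp: has_real_derivative_iff_has_vector_derivative)
  with g[OF sub[of z]] ab show "\<phi> a \<noteq> \<phi> b"
    by auto
qed

text \<open>A smooth function on an open interval without critical points is a diffeomorphism onto an open
  interval. The inverse \<open>\<psi>\<close> satisfies \<open>\<psi>' = 1 / (\<phi>' \<circ> \<psi>)\<close>, so it gains one order of
  differentiability at a time.\<close>

lemma diffeomorphism_onto_image:
  fixes \<phi> :: "real \<Rightarrow> real"
  assumes J: "open_interval J"
    and \<phi>: "smooth_on J \<phi>" "\<And>t. t \<in> J \<Longrightarrow> vderiv \<phi> t \<noteq> 0"
  shows "open_interval (\<phi> ` J)" "bij_betw \<phi> J (\<phi> ` J)"
    and "\<And>s. s \<in> \<phi> ` J \<Longrightarrow>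
      (inv_into J \<phi> has_vector_derivative inverse (vderiv \<phi> (inv_into J \<phi> s))) (at s)"
    and "smooth_on (\<phi> ` J) (inv_into J \<phi>)"
proof -
  let ?\<psi> = "inv_into J \<phi>"
  note oJ = open_intervalD(1)[OF J]
  note der = smooth_on_has_vector_derivative[OF oJ \<phi>(1)]
  have inj: "inj_on \<phi> J"
    by (rule inj_on_if_derivative_nonzero[OF J der \<phi>(2)])
  have cont: "continuous_on J \<phi>"
    by (rule smooth_on_continuous_on[OF \<phi>(1)])
  have oK: "open (\<phi> ` J)"
    by (rule invariance_of_domain_gen[OF oJ cont inj]) simp
  have "connected (\<phi> ` J)"
    using connected_continuous_image[OF cont] open_intervalD(2)[OF J] is_interval_connected
    by blast
  then show "open_interval (\<phi> ` J)"
    using oK open_intervalD(4)[OF J] by (simp add: open_interval_def is_interval_connected_1)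
  show "bij_betw \<phi> J (\<phi> ` J)"
    by (rule inj_on_imp_bij_betw[OF inj])
  show der_inv: "(?\<psi> has_vector_derivative inverse (vderiv \<phi> (?\<psi> s))) (at s)"
    if "s \<in> \<phi> ` J" for s
  proof -
    have mem: "?\<psi> s \<in> J" and eq: "\<phi> (?\<psi> s) = s"
      using that by (auto intro: inv_into_into f_inv_into_f)
    have "(?\<psi> has_derivative (\<lambda>h. h * inverse (vderiv \<phi> (?\<psi> s)))) (at (\<phi> (?\<psi> s)))"
    proof (rule has_derivative_inverse_strong[OF oJ mem cont])
      show "(\<phi> has_derivative (\<lambda>h. h * vderiv \<phi> (?\<psi> s))) (at (?\<psi> s))"
        using der[OF mem] by (simp add: has_vector_derivative_def)
      show "(\<lambda>h. h * vderiv \<phi> (?\<psi> s)) \<circ> (\<lambda>h. h * inverse (vderiv \<phi> (?\<psi> s))) = id"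
        using \<phi>(2)[OF mem] by (auto simp: fun_eq_iff)
    qed (simp add: inj)
    then show ?thesis
      by (simp add: eq has_vector_derivative_def)
  qed
  have "times_differentiable n (\<phi> ` J) ?\<psi>" for n
  proof (induction n)
    case (Suc n)
    have "smooth_on J (\<lambda>t. inverse (vderiv \<phi> t))"
      by (intro smooth_on_inverse oJ smooth_on_vderiv \<phi>)
    then have "times_differentiable n J (\<lambda>t. inverse (vderiv \<phi> t))"
      by (simp add: smooth_on_iff_times_differentiable[OF oJ])
    then have "times_differentiable n (\<phi> ` J) (\<lambda>s. inverse (vderiv \<phi> (?\<psi> s)))"
      by (rule times_differentiable_compose[rotated]) (auto intro: inv_into_into Suc.IH)
    with der_inv show ?case
      by (rule times_differentiable_SucI)
  qed simp
  then show "smooth_on (\<phi> ` J) ?\<psi>"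
    by (simp add: smooth_on_iff_times_differentiable[OF oK])
qed

lemma smooth_antiderivative:
  fixes g :: "real \<Rightarrow> real"
  assumes "open_interval J" "c \<in> J" "smooth_on J g"
  obtains \<phi> where "\<phi> c = 0" "\<And>t. t \<in> J \<Longrightarrow> (\<phi> has_vector_derivative g t) (at t)"
    "smooth_on J \<phi>"
proof -
  let ?\<phi> = "\<lambda>u. LBINT y=c..u. g y"
  have der: "(?\<phi> has_vector_derivative g t) (at t)" if "t \<in> J" for t
    by (intro has_vector_derivative_integral[OF assms(1,2) _ that] smooth_on_continuous_on assms(3))
  moreover have "smooth_on J ?\<phi>"
    by (rule smooth_on_if_derivative_smooth[OF open_intervalD(1)[OF assms(1)] der assms(3)])
  ultimately show thesis
    by (intro that[of ?\<phi>]) simp_all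
qed

section \<open>The moving frame of a spherical curve\<close>

lemma spherical_curveD:
  assumes "spherical_curve J \<gamma>"
  shows "open_interval J" "open J" "smooth_on J \<gamma>"
    and "\<And>t. t \<in> J \<Longrightarrow> vderiv \<gamma> t \<noteq> 0"
    and "\<And>t. t \<in> J \<Longrightarrow> norm (\<gamma> t) = 1"
    and "\<And>t. t \<in> J \<Longrightarrow> (\<gamma> has_vector_derivative vderiv \<gamma> t) (at t)"
proof -
  show 1: "open_interval J" "smooth_on J \<gamma>" "\<And>t. t \<in> J \<Longrightarrow> vderiv \<gamma> t \<noteq> 0"
    using assms by (auto simp: spherical_curve_def regular_curve_def)
  then show "open J"
    by (simp add: open_intervalD)
  then show "\<And>t. t \<in> J \<Longrightarrow> (\<gamma> has_vector_derivative vderiv \<gamma> t) (at t)"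
    by (rule smooth_on_has_vector_derivative[OF _ 1(2)])
  show "\<And>t. t \<in> J \<Longrightarrow> norm (\<gamma> t) = 1"
    using assms by (auto simp: spherical_curve_def)
qed

lemma spherical_curveI:
  assumes "open_interval J" "smooth_on J \<gamma>" "\<And>t. t \<in> J \<Longrightarrow> vderiv \<gamma> t \<noteq> 0"
    "\<And>t. t \<in> J \<Longrightarrow> norm (\<gamma> t) = 1"
  shows "spherical_curve J \<gamma>"
  using assms by (auto simp: spherical_curve_def regular_curve_def)

lemma derivative_of_constant_inner:
  fixes f g :: "real \<Rightarrow> 'a::real_inner"
  assumes "open J" "t \<in> J"
    and "(f has_vector_derivative f') (at t)" "(g has_vector_derivative g') (at t)"
    and "\<And>s. s \<in> J \<Longrightarrow> f s \<bullet> g s = c"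
  shows "f t \<bullet> g' + f' \<bullet> g t = 0"
proof -
  have "((\<lambda>s. f s \<bullet> g s) has_vector_derivative f t \<bullet> g' + f' \<bullet> g t) (at t)"
    by (rule bounded_bilinear.has_vector_derivative[OF bounded_bilinear_inner assms(3,4)])
  moreover have "((\<lambda>s. f s \<bullet> g s) has_vector_derivative 0) (at t)"
    by (rule has_vector_derivative_transform_within_open[OF _ assms(1,2), of "\<lambda>_. c"])
      (simp_all add: assms(5))
  ultimately show ?thesis
    by (rule vector_derivative_unique_at)
qed

lemma unit_vector_orthogonal_derivative:
  fixes f :: "real \<Rightarrow> 'a::real_inner"
  assumes "open J" "t \<in> J" "(f has_vector_derivative f') (at t)"
    and "\<And>s. s \<in> J \<Longrightarrow> norm (f s) = 1"
  shows "f t \<bullet> f' = 0"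
proof -
  have "f t \<bullet> f' + f' \<bullet> f t = 0"
    by (rule derivative_of_constant_inner[OF assms(1,2,3,3), of 1])
      (simp add: assms(4) dot_square_norm)
  then show ?thesis
    by (simp add: inner_commute)
qed

text \<open>The unit tangent of a spherical curve is a spherical curve. It is orthogonal to \<open>\<gamma>\<close>, and
  differentiating \<open>\<gamma> \<bullet> \<psi>\<^sub>1 = 0\<close> gives \<open>\<gamma> \<bullet> \<psi>\<^sub>1' = - \<parallel>\<gamma>'\<parallel> \<noteq> 0\<close>; hence \<open>\<psi>\<^sub>1'\<close> cannot
  vanish. By induction all \<open>\<psi>\<^sub>j\<close> of a spherical curve exist.\<close>

lemma spherical_curve_unit_tangent:
  assumes "spherical_curve J \<gamma>"
  shows "spherical_curve J (psi \<gamma> (Suc 0))"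
    and "\<And>t. t \<in> J \<Longrightarrow> vderiv \<gamma> t = norm (vderiv \<gamma> t) *\<^sub>R psi \<gamma> (Suc 0) t"
    and "\<And>t. t \<in> J \<Longrightarrow> \<gamma> t \<bullet> psi \<gamma> (Suc 0) t = 0"
    and "\<And>t. t \<in> J \<Longrightarrow> \<gamma> t \<bullet> vderiv (psi \<gamma> (Suc 0)) t = - norm (vderiv \<gamma> t)"
proof -
  let ?T = "psi \<gamma> (Suc 0)"
  note \<gamma> = spherical_curveD[OF assms]
  have smooth: "smooth_on J ?T"
    unfolding psi.simps
    by (intro smooth_on_scaleR smooth_on_inverse smooth_on_norm smooth_on_vderiv \<gamma>)
      (simp_all add: \<gamma>(4))
  show \<gamma>': "vderiv \<gamma> t = norm (vderiv \<gamma> t) *\<^sub>R ?T t" if "t \<in> J" for t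
    using \<gamma>(4)[OF that] by simp
  have unit: "norm (?T t) = 1" if "t \<in> J" for t
    using \<gamma>(4)[OF that] by simp
  have "\<gamma> t \<bullet> vderiv \<gamma> t = 0" if "t \<in> J" for t
    by (rule unit_vector_orthogonal_derivative[OF \<gamma>(2) that \<gamma>(6)[OF that] \<gamma>(5)])
  then show orth: "\<gamma> t \<bullet> ?T t = 0" if "t \<in> J" for t
    using that by simp
  show T': "\<gamma> t \<bullet> vderiv ?T t = - norm (vderiv \<gamma> t)" if "t \<in> J" for t
  proof -
    have "\<gamma> t \<bullet> vderiv ?T t + vderiv \<gamma> t \<bullet> ?T t = 0"
      by (rule derivative_of_constant_inner[OF \<gamma>(2) that \<gamma>(6)[OF that]
            smooth_on_has_vector_derivative[OF \<gamma>(2) smooth that] orth])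
    moreover have "vderiv \<gamma> t \<bullet> ?T t = norm (vderiv \<gamma> t)"
      using unit[OF that] by (subst \<gamma>'[OF that]) (simp add: dot_square_norm del: psi.simps)
    ultimately show ?thesis
      by linarith
  qed
  have "vderiv ?T t \<noteq> 0" if "t \<in> J" for t
    using T'[OF that] \<gamma>(4)[OF that] by (auto simp del: psi.simps)
  then show "spherical_curve J ?T"
    using \<gamma>(1) smooth unit by (intro spherical_curveI)
qed

lemma spherical_curve_psi:
  assumes "spherical_curve J \<alpha>"
  shows "spherical_curve J (psi \<alpha> j)"
proof (induction j)
  case (Suc j)
  then show ?case
    using spherical_curve_unit_tangent(1)[of J "psi \<alpha> j"] by simp
qed (simp add: assms)

text \<open>\<open>e\<close>, \<open>f\<close> and \<open>e \<times> f\<close> form a positively oriented orthonormal basis.\<close>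

lemma cross_product_frame:
  fixes e f :: "real^3"
  assumes "norm e = 1" "norm f = 1" "e \<bullet> f = 0"
  shows "cross3 f (cross3 e f) = e" "cross3 e (cross3 e f) = - f"
    and "x = (x \<bullet> e) *\<^sub>R e + (x \<bullet> f) *\<^sub>R f + (x \<bullet> cross3 e f) *\<^sub>R cross3 e f"
proof -
  have lagrange: "cross3 a (cross3 b c) = (a \<bullet> c) *\<^sub>R b - (a \<bullet> b) *\<^sub>R c" for a b c :: "real^3"
    by (simp add: cross3_simps forall_3)
  have "e \<bullet> e = 1" "f \<bullet> f = 1"
    using assms by (simp_all add: dot_square_norm)
  then show 1: "cross3 f (cross3 e f) = e" and 2: "cross3 e (cross3 e f) = - f"
    using assms(3) by (simp_all add: lagrange inner_commute)
  let ?n = "cross3 e f"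
  \<comment> \<open>Cramer's rule for \<open>e\<close>, \<open>f\<close>, \<open>?n\<close>, a polynomial identity valid for arbitrary vectors\<close>
  have "(e \<bullet> cross3 f ?n) *\<^sub>R x
      = (x \<bullet> cross3 f ?n) *\<^sub>R e + (x \<bullet> cross3 ?n e) *\<^sub>R f + (x \<bullet> cross3 e f) *\<^sub>R ?n"
    unfolding vec_eq_iff forall_3 cross3_def inner_vec_def sum_3
    by (simp add: algebra_simps)
  moreover have "cross3 ?n e = f"
    using 2 cross_skew[of ?n e] by simp
  ultimately show "x = (x \<bullet> e) *\<^sub>R e + (x \<bullet> f) *\<^sub>R f + (x \<bullet> cross3 e f) *\<^sub>R cross3 e f"
    using \<open>e \<bullet> e = 1\<close> by (simp add: 1)
qed

lemma bounded_bilinear_cross3: "bounded_bilinear cross3"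
  using bilinear_cross by (simp add: bilinear_conv_bounded_bilinear)

text \<open>The heart of the matter: \<open>I(\<gamma>)(\<cdot>, \<theta>)\<close> exhausts the curves \<open>\<beta>\<close> on the sphere whose
  derivative is a nowhere vanishing multiple of \<open>\<gamma>\<close>. Since \<open>\<beta> \<bullet> \<beta>' = 0\<close>, such a \<open>\<beta>\<close> is a
  combination \<open>A T + B N\<close> of the tangent \<open>T\<close> and the conormal \<open>N = \<gamma> \<times> T\<close>. The frame obeys
  \<open>\<gamma>' = v T\<close>, \<open>T' = g N - v \<gamma>\<close>, \<open>N' = - g T\<close>, where \<open>g\<close> is the integrand in \<open>S\<^sub>\<gamma>\<close>.
  Comparing coefficients in \<open>\<beta>' = h \<gamma>\<close> gives \<open>A' = g B\<close>, \<open>B' = - g A\<close> and \<open>h = - v A\<close>. So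
  \<open>(- A, B)\<close> is a point on the unit circle that rotates with angular velocity \<open>g\<close>, whence
  \<open>- A = cos (\<integral> g + \<theta>)\<close> and \<open>h = S\<^sub>\<gamma>\<close>.\<close>

lemma is_I_if_derivative_parallel:
  assumes \<gamma>: "spherical_curve J \<gamma>" "0 \<in> J"
    and \<beta>': "\<And>t. t \<in> J \<Longrightarrow> (\<beta> has_vector_derivative h t *\<^sub>R \<gamma> t) (at t)"
    and h: "\<And>t. t \<in> J \<Longrightarrow> h t \<noteq> 0"
    and \<beta>: "\<And>t. t \<in> J \<Longrightarrow> norm (\<beta> t) = 1"
  shows "\<exists>\<theta>. is_I J \<gamma> \<theta> \<beta>"
proof -
  define T where "T = psi \<gamma> (Suc 0)"
  define v where "v t = norm (vderiv \<gamma> t)" for t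
  define N where "N t = cross3 (\<gamma> t) (T t)" for t
  define g where "g t = det (vector [\<gamma> t, vderiv \<gamma> t, vderiv (vderiv \<gamma>) t] :: real^3^3)
    / (norm (vderiv \<gamma> t))\<^sup>2" for t
  define A where "A t = \<beta> t \<bullet> T t" for t
  define B where "B t = \<beta> t \<bullet> N t" for t
  note \<gamma>D = spherical_curveD[OF \<gamma>(1)]
  note J = \<gamma>D(2)
  note T = spherical_curve_unit_tangent[OF \<gamma>(1), folded T_def v_def]
  note TD = spherical_curveD[OF T(1)]
  have v0: "v t \<noteq> 0" if "t \<in> J" for t
    using \<gamma>D(4)[OF that] by (simp add: v_def)
  have v': "(v has_vector_derivative vderiv v t) (at t)" if "t \<in> J" for t
  proof -
    have "smooth_on J v"
      unfolding v_def by (intro smooth_on_norm smooth_on_vderiv \<gamma>D)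
    then show ?thesis
      by (rule smooth_on_has_vector_derivative[OF J _ that])
  qed
  have N_perp: "\<gamma> t \<bullet> N t = 0" "T t \<bullet> N t = 0" for t
    by (simp_all add: N_def dot_cross_self)
  have frame: "x = (x \<bullet> \<gamma> t) *\<^sub>R \<gamma> t + (x \<bullet> T t) *\<^sub>R T t + (x \<bullet> N t) *\<^sub>R N t"
    and \<gamma>_cross_N: "cross3 (\<gamma> t) (N t) = - T t" if "t \<in> J" for t x
    using cross_product_frame[OF \<gamma>D(5)[OF that] TD(5)[OF that] T(3)[OF that]]
    by (simp_all add: N_def)

  have g: "g t = vderiv T t \<bullet> N t" if "t \<in> J" for t
  proof -
    have "((\<lambda>s. v s *\<^sub>R T s) has_vector_derivative v t *\<^sub>R vderiv T t + vderiv v t *\<^sub>R T t) (at t)"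
      by (rule bounded_bilinear.has_vector_derivative[OF bounded_bilinear_scaleR v'[OF that]
            TD(6)[OF that]])
    then have "(vderiv \<gamma> has_vector_derivative v t *\<^sub>R vderiv T t + vderiv v t *\<^sub>R T t) (at t)"
      by (rule has_vector_derivative_transform_within_open[OF _ J that]) (simp add: T(2))
    then have "vderiv (vderiv \<gamma>) t = v t *\<^sub>R vderiv T t + vderiv v t *\<^sub>R T t"
      by (rule vector_derivative_at)
    then have "g t = \<gamma> t \<bullet> cross3 (v t *\<^sub>R T t) (v t *\<^sub>R vderiv T t + vderiv v t *\<^sub>R T t) / (v t)\<^sup>2"
      unfolding g_def dot_cross_det[symmetric] v_def[symmetric] T(2)[OF that, symmetric] by simp
    also have "\<dots> = \<gamma> t \<bullet> cross3 (T t) (vderiv T t)"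
      using v0[OF that]
      by (simp add: cross_add_right cross_mult_left cross_mult_right power2_eq_square)
    also have "\<dots> = vderiv T t \<bullet> N t"
      unfolding N_def by (simp add: cross3_simps)
    finally show ?thesis .
  qed
  have "\<beta> t \<bullet> (h t *\<^sub>R \<gamma> t) = 0" if "t \<in> J" for t
    by (rule unit_vector_orthogonal_derivative[OF J that \<beta>'[OF that] \<beta>])
  then have \<beta>_perp: "\<beta> t \<bullet> \<gamma> t = 0" if "t \<in> J" for t
    using that h by auto
  have T': "vderiv T t = g t *\<^sub>R N t - v t *\<^sub>R \<gamma> t" if "t \<in> J" for t
  proof -
    have "T t \<bullet> vderiv T t = 0"
      by (rule unit_vector_orthogonal_derivative[OF J that TD(6)[OF that] TD(5)])
    then show ?thesis
      using frame[OF that, of "vderiv T t"] T(4)[OF that] g[OF that]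
      by (simp add: inner_commute)
  qed
  have A': "(A has_vector_derivative g t * B t) (at t)" if "t \<in> J" for t
  proof -
    have "(A has_vector_derivative \<beta> t \<bullet> vderiv T t + (h t *\<^sub>R \<gamma> t) \<bullet> T t) (at t)"
      unfolding A_def
      by (rule bounded_bilinear.has_vector_derivative[OF bounded_bilinear_inner \<beta>'[OF that]
            TD(6)[OF that]])
    also have "\<beta> t \<bullet> vderiv T t + (h t *\<^sub>R \<gamma> t) \<bullet> T t = g t * B t"
      by (simp add: T'[OF that] inner_diff_right \<beta>_perp[OF that] T(3)[OF that] B_def)
    finally show ?thesis .
  qed
  have B': "(B has_vector_derivative - (g t * A t)) (at t)" if "t \<in> J" for t
  proof -
    have "(N has_vector_derivative cross3 (\<gamma> t) (vderiv T t) + cross3 (vderiv \<gamma> t) (T t)) (at t)"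
      unfolding N_def
      by (rule bounded_bilinear.has_vector_derivative[OF bounded_bilinear_cross3 \<gamma>D(6)[OF that]
            TD(6)[OF that]])
    also have "cross3 (\<gamma> t) (vderiv T t) + cross3 (vderiv \<gamma> t) (T t) = - (g t *\<^sub>R T t)"
      unfolding T'[OF that] T(2)[OF that]
      by (simp add: Cross3.right_diff_distrib cross_mult_left cross_mult_right \<gamma>_cross_N[OF that])
    finally have "(B has_vector_derivative \<beta> t \<bullet> - (g t *\<^sub>R T t) + (h t *\<^sub>R \<gamma> t) \<bullet> N t) (at t)"
      unfolding B_def
      by (rule bounded_bilinear.has_vector_derivative[OF bounded_bilinear_inner \<beta>'[OF that]])
    also have "\<beta> t \<bullet> - (g t *\<^sub>R T t) + (h t *\<^sub>R \<gamma> t) \<bullet> N t = - (g t * A t)"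
      by (simp add: N_perp A_def)
    finally show ?thesis .
  qed
  have h_eq: "h t = - (v t * A t)" if "t \<in> J" for t
  proof -
    have "\<beta> t \<bullet> vderiv \<gamma> t + (h t *\<^sub>R \<gamma> t) \<bullet> \<gamma> t = 0"
      by (rule derivative_of_constant_inner[OF J that \<beta>'[OF that] \<gamma>D(6)[OF that] \<beta>_perp])
    then show ?thesis
      unfolding T(2)[OF that] using \<gamma>D(5)[OF that] by (simp add: A_def dot_square_norm)
  qed

  \<comment> \<open>The constant \<open>\<theta>\<close> is the polar angle of \<open>(- A, B)\<close> at parameter 0.\<close>
  have "(- A 0)\<^sup>2 + (B 0)\<^sup>2 = \<beta> 0 \<bullet> \<beta> 0"
    by (subst (2) frame[OF \<gamma>(2), of "\<beta> 0"])
      (simp add: inner_add_right \<beta>_perp[OF \<gamma>(2)] A_def B_def power2_eq_square)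
  also have "\<dots> = 1"
    using \<beta>[OF \<gamma>(2)] by (simp add: dot_square_norm)
  finally obtain \<theta> where \<theta>: "- A 0 = cos \<theta>" "B 0 = sin \<theta>"
    by (rule sincos_total_2pi)
  define \<Theta> where "\<Theta> t = (LBINT u=0..t. g u) + \<theta>" for t :: real
  have "continuous_on J g"
  proof -
    have "continuous_on J (\<lambda>t. \<gamma> t \<bullet> cross3 (vderiv \<gamma> t) (vderiv (vderiv \<gamma>) t) / (v t)\<^sup>2)"
      using v0 unfolding v_def
      by (intro continuous_intros continuous_on_cross smooth_on_continuous_on smooth_on_vderiv \<gamma>D)
        auto
    then show ?thesis
      by (simp add: g_def[abs_def] dot_cross_det v_def)
  qed
  then have \<Theta>': "(\<Theta> has_vector_derivative g t) (at t)" if "t \<in> J" for t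
    using has_vector_derivative_integral[OF \<gamma>D(1) \<gamma>(2) _ that]
    unfolding \<Theta>_def has_vector_derivative_add_const by (simp add: zero_ereal_def)
  have \<Theta>0: "\<Theta> 0 = \<theta>"
    by (simp add: \<Theta>_def zero_ereal_def[symmetric])
  have A_eq: "- A t = 1 * cos (\<Theta> t)" if "t \<in> J" for t
  proof (rule rotation_system_solution(1)[OF \<gamma>D(1) \<gamma>(2) that, where y = B and w = g])
    fix t assume "t \<in> J"
    show "((\<lambda>a. - A a) has_vector_derivative - (g t * B t)) (at t)"
      by (intro has_vector_derivative_minus A' \<open>t \<in> J\<close>)
    show "(B has_vector_derivative g t * - A t) (at t)"
      using B'[OF \<open>t \<in> J\<close>] by simp
  qed (simp_all add: \<Theta>' \<theta> \<Theta>0)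
  have "S_fun \<gamma> \<theta> t = h t" if "t \<in> J" for t
  proof -
    have "S_fun \<gamma> \<theta> t = v t * (1 * cos (\<Theta> t))"
      by (simp add: S_fun_def v_def \<Theta>_def g_def)
    also have "\<dots> = h t"
      by (simp only: A_eq[OF that, symmetric] h_eq[OF that] mult_minus_right)
    finally show ?thesis .
  qed
  then have "is_I J \<gamma> \<theta> \<beta>"
    using \<gamma> \<beta>' \<beta> by (auto simp: is_I_def)
  then show ?thesis ..
qed

section \<open>Descending from the last tangent to the curve\<close>

lemma reparametrization_inverse_derivative:
  fixes f :: "real \<Rightarrow> 'a::real_normed_vector"
  assumes J: "open_interval J" and \<phi>: "smooth_on J \<phi>" "\<And>t. t \<in> J \<Longrightarrow> vderiv \<phi> t \<noteq> 0"
    and f: "smooth_on J f" and s: "s \<in> \<phi> ` J"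
  shows "((\<lambda>s. f (inv_into J \<phi> s)) has_vector_derivative
    inverse (vderiv \<phi> (inv_into J \<phi> s)) *\<^sub>R vderiv f (inv_into J \<phi> s)) (at s)"
proof -
  have "inv_into J \<phi> s \<in> J"
    using s by (rule inv_into_into)
  then show ?thesis
    using vector_diff_chain_at[OF diffeomorphism_onto_image(3)[OF J \<phi> s]
        smooth_on_has_vector_derivative[OF open_intervalD(1)[OF J] f]]
    by (simp add: o_def)
qed

lemma spherical_curve_reparametrize:
  assumes f: "spherical_curve J f"
    and \<phi>: "smooth_on J \<phi>" "\<And>t. t \<in> J \<Longrightarrow> vderiv \<phi> t \<noteq> 0"
  shows "spherical_curve (\<phi> ` J) (\<lambda>s. f (inv_into J \<phi> s))"
proof -
  note fD = spherical_curveD[OF f]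
  note \<phi>' = diffeomorphism_onto_image[OF fD(1) \<phi>]
  have mem: "inv_into J \<phi> s \<in> J" if "s \<in> \<phi> ` J" for s
    using that by (rule inv_into_into)
  show ?thesis
  proof (rule spherical_curveI)
    show "smooth_on (\<phi> ` J) (\<lambda>s. f (inv_into J \<phi> s))"
      by (rule smooth_on_compose[OF fD(2) open_intervalD(1)[OF \<phi>'(1)] mem fD(3) \<phi>'(4)])
    fix s assume s: "s \<in> \<phi> ` J"
    have "vderiv (\<lambda>s. f (inv_into J \<phi> s)) s
        = inverse (vderiv \<phi> (inv_into J \<phi> s)) *\<^sub>R vderiv f (inv_into J \<phi> s)"
      by (rule vector_derivative_at[OF reparametrization_inverse_derivative[OF fD(1) \<phi> fD(3) s]])
    then show "vderiv (\<lambda>s. f (inv_into J \<phi> s)) s \<noteq> 0"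
      using \<phi>(2) fD(4) mem[OF s] by simp
    show "norm (f (inv_into J \<phi> s)) = 1"
      using fD(5) mem[OF s] .
  qed (rule \<phi>'(1))
qed

text \<open>Suppose that \<open>\<phi>\<close> identifies \<open>\<psi>\<^sub>k\<^sub>+\<^sub>1\<close> with \<open>\<gamma>\<close>. In the parameter of \<open>\<gamma>\<close>, the derivative of
  each \<open>\<psi>\<^sub>j\<close> is a nowhere vanishing multiple of \<open>\<psi>\<^sub>j\<^sub>+\<^sub>1\<close>, negative if \<open>\<phi>\<close> reverses the
  orientation. So \<open>\<psi>\<^sub>j\<close> is a version of \<open>I(\<psi>\<^sub>j\<^sub>+\<^sub>1)\<close>, and \<open>k + 1\<close> steps lead from \<open>\<gamma>\<close> down to
  \<open>\<psi>\<^sub>0 = \<alpha>\<close>.\<close>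

lemma iterated_I_of_psi:
  assumes \<alpha>: "spherical_curve J \<alpha>"
    and \<phi>: "smooth_on J \<phi>" "\<And>t. t \<in> J \<Longrightarrow> vderiv \<phi> t \<noteq> 0"
    and K: "\<phi> ` J = K" "0 \<in> K"
    and \<gamma>: "spherical_curve K \<gamma>" "\<And>t. t \<in> J \<Longrightarrow> psi \<alpha> (Suc k) t = \<gamma> (\<phi> t)"
  shows "\<exists>\<theta> \<beta>. is_I_iter (k + 1) K \<gamma> \<theta> \<beta> \<and> reparametrization J \<alpha> K \<beta>"
proof -
  let ?\<iota> = "inv_into J \<phi>"
  note J = spherical_curveD(1)[OF \<alpha>]
  note diffeo = diffeomorphism_onto_image[OF J \<phi>, unfolded K(1)]
  have mem: "?\<iota> s \<in> J" and inv: "\<phi> (?\<iota> s) = s" if "s \<in> K" for s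
    using that K(1) by (auto intro: inv_into_into f_inv_into_f)
  \<comment> \<open>\<open>\<delta> 0\<close> has to be \<open>\<gamma>\<close> on the whole line, since the iteration of \<open>I\<close> starts with an equality of
    functions; on \<open>K\<close> all \<open>\<delta> n\<close> are given by one formula.\<close>
  define \<delta> where "\<delta> n = (if n = 0 then \<gamma> else (\<lambda>s. psi \<alpha> (Suc k - n) (?\<iota> s)))" for n
  have \<delta>_eq: "\<delta> n s = psi \<alpha> (Suc k - n) (?\<iota> s)" if "s \<in> K" for n s
    using \<gamma>(2)[OF mem[OF that]] inv[OF that] by (simp add: \<delta>_def del: psi.simps)
  have spherical: "spherical_curve K (\<delta> n)" for n
    using \<gamma>(1) spherical_curve_reparametrize[OF spherical_curve_psi[OF \<alpha>] \<phi>]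
    by (simp add: \<delta>_def K(1))
  have "\<exists>\<theta>. is_I K (\<delta> n) \<theta> (\<delta> (Suc n))" if "n \<le> k" for n
  proof (rule is_I_if_derivative_parallel[OF spherical K(2)])
    fix s assume s: "s \<in> K"
    let ?f = "psi \<alpha> (k - n)"
    let ?h = "\<lambda>s. inverse (vderiv \<phi> (?\<iota> s)) * norm (vderiv ?f (?\<iota> s))"
    note f = spherical_curve_psi[OF \<alpha>, of "k - n"]
    have "vderiv ?f (?\<iota> s) = norm (vderiv ?f (?\<iota> s)) *\<^sub>R \<delta> n s"
      using spherical_curve_unit_tangent(2)[OF f mem[OF s]] that
      by (simp add: \<delta>_eq[OF s] Suc_diff_le)
    then have "inverse (vderiv \<phi> (?\<iota> s)) *\<^sub>R vderiv ?f (?\<iota> s) = ?h s *\<^sub>R \<delta> n s"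
      by (metis scaleR_scaleR)
    moreover have "\<delta> (Suc n) = (\<lambda>s. ?f (?\<iota> s))"
      by (simp add: \<delta>_def)
    ultimately show "(\<delta> (Suc n) has_vector_derivative ?h s *\<^sub>R \<delta> n s) (at s)"
      using reparametrization_inverse_derivative[OF J \<phi> spherical_curveD(3)[OF f]] s K(1)
      by metis
    show "?h s \<noteq> 0"
      using \<phi>(2) spherical_curveD(4)[OF f] mem[OF s] by simp
    show "norm (\<delta> (Suc n) s) = 1"
      using spherical_curveD(5)[OF spherical s] .
  qed
  then obtain \<theta> where \<theta>: "\<And>n. n \<le> k \<Longrightarrow> is_I K (\<delta> n) (\<theta> n) (\<delta> (Suc n))"
    by metis
  have "is_I_iter n K \<gamma> \<theta> (\<delta> n)" if "n \<le> k + 1" for n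
    using that
  proof (induction n)
    case (Suc n)
    then show ?case
      using \<theta>[of n] by auto
  qed (simp add: \<delta>_def)
  moreover have "reparametrization J \<alpha> K (\<delta> (k + 1))"
    unfolding reparametrization_def
  proof (intro exI[of _ \<phi>] conjI ballI \<phi> diffeo(2))
    fix t assume t: "t \<in> J"
    then have "?\<iota> (\<phi> t) = t"
      using diffeo(2) by (simp add: bij_betw_inv_into_left)
    then show "\<alpha> t = \<delta> (k + 1) (\<phi> t)"
      by (simp add: \<delta>_def)
  qed
  ultimately show ?thesis
    by blast
qed

section \<open>Slant curves and circles\<close>

text \<open>A constant angle puts \<open>\<psi>\<^sub>k\<^sub>+\<^sub>1\<close> on a plane section \<open>x \<bullet> u = a \<parallel>u\<parallel>\<close> of the sphere. The section
  is a proper circle: for \<open>a = \<plusminus>1\<close> it is a single point, but \<open>\<psi>\<^sub>k\<^sub>+\<^sub>1\<close> is regular.\<close>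

lemma k_slant_psi_on_circle:
  assumes \<alpha>: "spherical_curve J \<alpha>" and slant: "k_slant_with_axis k J \<alpha> u"
  obtains a where "a\<^sup>2 < 1" "\<And>t. t \<in> J \<Longrightarrow> psi \<alpha> (Suc k) t \<bullet> u = a * norm u"
proof -
  let ?\<psi> = "psi \<alpha> (Suc k)"
  note \<psi> = spherical_curveD[OF spherical_curve_psi[OF \<alpha>, of "Suc k"]]
  have u: "u \<noteq> 0"
    using slant by (simp add: k_slant_with_axis_def)
  obtain \<omega> where \<omega>: "\<And>t. t \<in> J \<Longrightarrow> vec_angle (?\<psi> t) u = \<omega>"
    using slant by (auto simp: k_slant_with_axis_def)
  have inner: "?\<psi> t \<bullet> u = cos \<omega> * norm u" if "t \<in> J" for t
  proof -
    have "\<bar>?\<psi> t \<bullet> u / norm u\<bar> \<le> 1"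
      using Cauchy_Schwarz_ineq2[of "?\<psi> t" u] \<psi>(5)[OF that] u
      by (simp add: divide_le_eq del: psi.simps)
    then have "cos (vec_angle (?\<psi> t) u) = ?\<psi> t \<bullet> u / norm u"
      unfolding vec_angle_def \<psi>(5)[OF that] by (simp add: cos_arccos_abs del: psi.simps)
    then show ?thesis
      using u by (simp add: \<omega>[OF that] del: psi.simps)
  qed
  have "(cos \<omega>)\<^sup>2 \<noteq> 1"
  proof
    assume one: "(cos \<omega>)\<^sup>2 = 1"
    define e where "e = (cos \<omega> / norm u) *\<^sub>R u"
    have const: "?\<psi> t = e" if "t \<in> J" for t
    proof -
      have "(norm (?\<psi> t - e))\<^sup>2 = (norm (?\<psi> t))\<^sup>2 + (norm e)\<^sup>2 - 2 * (?\<psi> t \<bullet> e)"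
        unfolding power2_norm_eq_inner by (simp add: inner_diff inner_commute del: psi.simps)
      also have "\<dots> = 1 + (cos \<omega>)\<^sup>2 - 2 * (cos \<omega>)\<^sup>2"
        using u by (simp add: e_def \<psi>(5)[OF that] inner[OF that] power2_eq_square del: psi.simps)
      finally show ?thesis
        by (simp add: one del: psi.simps)
    qed
    obtain t where t: "t \<in> J"
      using open_intervalD(4)[OF \<psi>(1)] by blast
    have "(?\<psi> has_vector_derivative 0) (at t)"
      by (rule has_vector_derivative_transform_within_open[OF _ \<psi>(2) t, of "\<lambda>_. e"])
        (simp_all add: const del: psi.simps)
    then show False
      using \<psi>(4)[OF t] vector_derivative_at by blast
  qed
  then have "(cos \<omega>)\<^sup>2 < 1"
    using cos_squared_eq[of \<omega>] by (simp add: order_less_le)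
  with inner show thesis
    by (rule that[rotated])
qed

lemma spherical_curve_std_circle_shifted:
  assumes J: "open_interval J" and ra: "r > 0" "a\<^sup>2 + r\<^sup>2 = 1"
  shows "spherical_curve J (shift_curve c (std_circle r a))"
proof -
  define E :: "real^3 \<Rightarrow> real^3 \<Rightarrow> real^3 \<Rightarrow> real \<Rightarrow> real^3"
    where "E A B D s = cos ((s + c) / r) *\<^sub>R A + sin ((s + c) / r) *\<^sub>R B + D" for A B D s
  have E': "(E A B D has_vector_derivative E ((1 / r) *\<^sub>R B) (- (1 / r) *\<^sub>R A) 0 s) (at s)" for A B D s
    unfolding E_def using ra(1) by (auto intro!: derivative_eq_intros simp: algebra_simps)
  have circle: "shift_curve c (std_circle r a) = E (vector [r, 0, 0]) (vector [0, r, 0]) (vector [0, 0, a])"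
    by (simp add: fun_eq_iff shift_curve_def std_circle_def E_def vec_eq_iff forall_3)
  show ?thesis
  proof (rule spherical_curveI[OF J])
    show "smooth_on J (shift_curve c (std_circle r a))"
    proof (rule smooth_on_coinduct[OF open_intervalD(1)[OF J], of "\<lambda>f. \<exists>A B D. f = E A B D"])
      show "\<exists>A B D. shift_curve c (std_circle r a) = E A B D"
        using circle by blast
    qed (use E' in blast)
    fix s
    have "vderiv (shift_curve c (std_circle r a)) s
        = E (vector [0, 1, 0]) (vector [-1, 0, 0]) 0 s"
      unfolding circle vector_derivative_at[OF E'] using ra(1)
      by (simp add: E_def vec_eq_iff forall_3)
    also have "norm \<dots> = 1"
      by (simp add: E_def norm_eq_1 inner_vec_def sum_3 power2_eq_square[symmetric])
    finally show "vderiv (shift_curve c (std_circle r a)) s \<noteq> 0"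
      by auto
    have "(r * cos ((s + c) / r))\<^sup>2 + (r * sin ((s + c) / r))\<^sup>2 = r\<^sup>2"
      by (simp add: power_mult_distrib distrib_left[symmetric])
    then show "norm (shift_curve c (std_circle r a) s) = 1"
      using ra(2) unfolding norm_eq_1
      by (simp add: shift_curve_def std_circle_def inner_vec_def sum_3 power2_eq_square[symmetric])
  qed
qed

text \<open>On a great circle every \<open>\<psi>\<^sub>j\<close> stays in the plane of the circle, because this plane is a linear
  subspace. So the angle with the normal of the plane is \<open>\<pi> / 2\<close> for every \<open>j\<close>.\<close>

lemma exists_spherical_k_slant: "\<exists>J \<alpha>. spherical_curve J \<alpha> \<and> k_slant k J \<alpha>"
proof -
  define \<alpha> where "\<alpha> = shift_curve 0 (std_circle 1 0)"
  define u :: "real^3" where "u = vector [0, 0, 1]"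
  have UNIV: "open_interval UNIV"
    by (simp add: open_interval_def is_interval_def)
  then have \<alpha>: "spherical_curve UNIV \<alpha>"
    unfolding \<alpha>_def by (rule spherical_curve_std_circle_shifted) simp_all
  have "norm u = 1"
    by (simp add: u_def norm_eq_1 inner_vec_def sum_3)
  then have u: "u \<noteq> 0"
    by auto
  have perp: "psi \<alpha> j t \<bullet> u = 0" for j t
  proof (induction j arbitrary: t)
    case 0
    show ?case
      by (simp add: \<alpha>_def shift_curve_def std_circle_def u_def inner_vec_def sum_3)
  next
    case (Suc j)
    have "psi \<alpha> j t \<bullet> 0 + vderiv (psi \<alpha> j) t \<bullet> u = 0"
      by (rule derivative_of_constant_inner[OF open_UNIV UNIV_I
            spherical_curveD(6)[OF spherical_curve_psi[OF \<alpha>] UNIV_I]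
            has_vector_derivative_const Suc.IH])
    then show ?case
      by simp
  qed
  have "k_slant_with_axis k UNIV \<alpha> u"
    unfolding k_slant_with_axis_def
  proof (intro conjI ballI exI u)
    show "regular_curve UNIV \<alpha>"
      using \<alpha> by (simp add: spherical_curve_def)
    show "vderiv (psi \<alpha> j) t \<noteq> 0" if "t \<in> UNIV" for j t
      by (rule spherical_curveD(4)[OF spherical_curve_psi[OF \<alpha>] that])
    show "vec_angle (psi \<alpha> (Suc k) t) u = arccos 0" for t
      by (simp only: vec_angle_def perp div_0)
  qed
  then show ?thesis
    using \<alpha> by (auto simp: k_slant_def)
qed

text \<open>For the vertical axis, \<open>\<psi>\<^sub>k\<^sub>+\<^sub>1 = (x, y, a)\<close> with \<open>x\<^sup>2 + y\<^sup>2 = r\<^sup>2\<close>, and the polar angle of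
  \<open>(x, y)\<close> changes at the rate \<open>(x y' - y x') / r\<^sup>2\<close>, which never vanishes since \<open>\<psi>\<^sub>k\<^sub>+\<^sub>1\<close> is
  regular. The parameter on the standard circle is \<open>r\<close> times this angle; it decreases if the
  circle is traversed clockwise.\<close>

lemma k_slant_vertical_axis_from_std_circle:
  assumes \<alpha>: "spherical_curve J \<alpha>" and slant: "k_slant_with_axis k J \<alpha> (vector [0, 0, 1])"
  shows "\<exists>r a K c \<theta> \<beta>. r > 0 \<and> a\<^sup>2 + r\<^sup>2 = 1 \<and> open_interval K \<and> c \<in> K \<and>
    is_I_iter (k + 1) (shift_interval c K) (shift_curve c (std_circle r a)) \<theta> \<beta> \<and>
    reparametrization J \<alpha> (shift_interval c K) \<beta>"
proof -
  let ?\<psi> = "psi \<alpha> (Suc k)"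
  note \<psi>_spherical = spherical_curve_psi[OF \<alpha>, of "Suc k"]
  note \<psi> = spherical_curveD[OF \<psi>_spherical]
  let ?e = "vector [0, 0, 1] :: real^3"
  have "norm ?e = 1"
    by (simp add: norm_eq_1 inner_vec_def sum_3)
  then obtain a where a: "a\<^sup>2 < 1" "\<And>t. t \<in> J \<Longrightarrow> ?\<psi> t \<bullet> ?e = a"
    using k_slant_psi_on_circle[OF \<alpha> slant] by (metis mult.right_neutral)
  define r where "r = sqrt (1 - a\<^sup>2)"
  have r: "r > 0" "a\<^sup>2 + r\<^sup>2 = 1"
    using a(1) by (simp_all add: r_def)
  define x y x' y' where "x t = ?\<psi> t $ 1" and "y t = ?\<psi> t $ 2"
    and "x' t = vderiv ?\<psi> t $ 1" and "y' t = vderiv ?\<psi> t $ 2" for t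
  have der: "(x has_vector_derivative x' t) (at t)" "(y has_vector_derivative y' t) (at t)"
    if "t \<in> J" for t
    using bounded_linear.has_vector_derivative[OF bounded_linear_vec_nth \<psi>(6)[OF that]]
    by (simp_all add: x_def[abs_def] y_def[abs_def] x'_def y'_def del: psi.simps)
  have z: "?\<psi> t $ 3 = a" if "t \<in> J" for t
    using a(2)[OF that] by (simp add: inner_vec_def sum_3 del: psi.simps)
  have z': "vderiv ?\<psi> t $ 3 = 0" if "t \<in> J" for t
  proof -
    have "?\<psi> t \<bullet> 0 + vderiv ?\<psi> t \<bullet> ?e = 0"
      by (rule derivative_of_constant_inner[OF \<psi>(2) that \<psi>(6)[OF that]
            has_vector_derivative_const a(2)])
    then show ?thesis
      by (simp add: inner_vec_def sum_3 del: psi.simps)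
  qed
  have xy: "(x t)\<^sup>2 + (y t)\<^sup>2 = r\<^sup>2" if "t \<in> J" for t
  proof -
    have "?\<psi> t \<bullet> ?\<psi> t = 1"
      using \<psi>(5)[OF that] by (simp only: norm_eq_1)
    then have "(x t)\<^sup>2 + (y t)\<^sup>2 + a\<^sup>2 = 1"
      by (simp add: inner_vec_def sum_3 z[OF that] x_def y_def power2_eq_square del: psi.simps)
    with r(2) show ?thesis
      by linarith
  qed
  have xy': "x t * x' t + y t * y' t = 0" if "t \<in> J" for t
  proof -
    have "?\<psi> t \<bullet> vderiv ?\<psi> t = 0"
      by (rule unit_vector_orthogonal_derivative[OF \<psi>(2) that \<psi>(6)[OF that] \<psi>(5)])
    then show ?thesis
      by (simp add: inner_vec_def sum_3 z'[OF that] x_def y_def x'_def y'_def del: psi.simps)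
  qed

  define g where "g t = (x t * y' t - y t * x' t) / r" for t
  have rot: "x' t = - (g t / r * y t)" "y' t = g t / r * x t" if "t \<in> J" for t
  proof -
    have "r\<^sup>2 * x' t = - (r * g t * y t)" "r\<^sup>2 * y' t = r * g t * x t"
      unfolding xy[OF that, symmetric] using r(1) xy'[OF that] by (simp_all add: g_def) algebra+
    then have "r * (r * x' t) = r * - (g t * y t)" "r * (r * y' t) = r * (g t * x t)"
      by (simp_all add: power2_eq_square algebra_simps)
    then show "x' t = - (g t / r * y t)" "y' t = g t / r * x t"
      unfolding mult_left_cancel[OF less_imp_neq[OF r(1), symmetric]]
      using r(1) by (simp_all add: field_simps)
  qed
  have g0: "g t \<noteq> 0" if "t \<in> J" for t
  proof
    assume "g t = 0"
    then have "vderiv ?\<psi> t = 0"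
      using rot[OF that] z'[OF that]
      by (simp add: vec_eq_iff forall_3 x'_def y'_def del: psi.simps)
    with \<psi>(4)[OF that] show False ..
  qed
  have g_smooth: "smooth_on J g"
  proof -
    have "smooth_on J (\<lambda>t. cross3 (?\<psi> t) (vderiv ?\<psi> t) $ 3 / r)"
      by (intro bounded_linear.smooth_on[OF bounded_linear_divide]
          bounded_linear.smooth_on[OF bounded_linear_vec_nth]
          bounded_bilinear.smooth_on[OF bounded_bilinear_cross3] smooth_on_vderiv \<psi>)
    then show ?thesis
      by (simp add: g_def[abs_def] cross_components x_def y_def x'_def y'_def mult.commute
          del: psi.simps)
  qed

  obtain t\<^sub>0 where t\<^sub>0: "t\<^sub>0 \<in> J"
    using open_intervalD(4)[OF \<psi>(1)] by blast
  obtain \<phi> where \<phi>: "\<phi> t\<^sub>0 = 0" "\<And>t. t \<in> J \<Longrightarrow> (\<phi> has_vector_derivative g t) (at t)"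
      "smooth_on J \<phi>"
    using smooth_antiderivative[OF \<psi>(1) t\<^sub>0 g_smooth] by blast
  have "(x t\<^sub>0 / r)\<^sup>2 + (y t\<^sub>0 / r)\<^sup>2 = 1"
    using xy[OF t\<^sub>0] r(1) by (simp add: power_divide add_divide_distrib[symmetric])
  then obtain \<theta>\<^sub>0 where \<theta>\<^sub>0: "x t\<^sub>0 / r = cos \<theta>\<^sub>0" "y t\<^sub>0 / r = sin \<theta>\<^sub>0"
    by (rule sincos_total_2pi)
  \<comment> \<open>\<open>\<phi>\<close> vanishes at \<open>t\<^sub>0\<close>, so the parameter of \<open>std_circle r a\<close> is \<open>\<phi> + c\<close> with \<open>c\<close> its value at
    \<open>t\<^sub>0\<close>; moving \<open>c\<close> to 0 leaves \<open>\<phi>\<close>.\<close>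
  define c where "c = r * \<theta>\<^sub>0"
  define K where "K = (\<lambda>t. \<phi> t + c) ` J"
  have \<phi>c': "((\<lambda>t. \<phi> t + c) has_vector_derivative g t) (at t)" if "t \<in> J" for t
    unfolding has_vector_derivative_add_const by (rule \<phi>(2)[OF that])
  have K: "open_interval K"
    unfolding K_def
  proof (rule diffeomorphism_onto_image(1)[OF \<psi>(1)])
    show "smooth_on J (\<lambda>t. \<phi> t + c)"
      by (rule smooth_on_if_derivative_smooth[OF \<psi>(2) \<phi>c' g_smooth])
    show "vderiv (\<lambda>t. \<phi> t + c) t \<noteq> 0" if "t \<in> J" for t
      using vector_derivative_at[OF \<phi>c'[OF that]] g0[OF that] by simp
  qed
  have K_shift: "shift_interval c K = \<phi> ` J"
    by (simp add: shift_interval_def K_def image_image)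
  have c: "c \<in> K"
    unfolding K_def using t\<^sub>0 \<phi>(1) by force
  have vderiv_\<phi>: "vderiv \<phi> t \<noteq> 0" if "t \<in> J" for t
    using vector_derivative_at[OF \<phi>(2)[OF that]] g0[OF that] by simp
  have "\<exists>\<theta> \<beta>. is_I_iter (k + 1) (\<phi> ` J) (shift_curve c (std_circle r a)) \<theta> \<beta> \<and>
      reparametrization J \<alpha> (\<phi> ` J) \<beta>"
  proof (rule iterated_I_of_psi[OF \<alpha> \<phi>(3) vderiv_\<phi> refl])
    show "0 \<in> \<phi> ` J"
      using t\<^sub>0 \<phi>(1) by force
    show "spherical_curve (\<phi> ` J) (shift_curve c (std_circle r a))"
      by (rule spherical_curve_std_circle_shifted[OF _ r])
        (rule diffeomorphism_onto_image(1)[OF \<psi>(1) \<phi>(3) vderiv_\<phi>])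
    fix t assume t: "t \<in> J"
    define \<Theta> where "\<Theta> t = (\<phi> t + c) / r" for t
    have \<Theta>': "(\<Theta> has_vector_derivative g t / r) (at t)" if "t \<in> J" for t
      unfolding \<Theta>_def
      by (rule bounded_linear.has_vector_derivative[OF bounded_linear_divide \<phi>c'[OF that]])
    have \<Theta>0: "\<Theta> t\<^sub>0 = \<theta>\<^sub>0"
      using r(1) by (simp add: \<Theta>_def \<phi>(1) c_def)
    have "x t = r * cos (\<Theta> t)" "y t = r * sin (\<Theta> t)"
      using rotation_system_solution[OF \<psi>(1) t\<^sub>0 t, of x "\<lambda>t. g t / r" y \<Theta> r]
        der rot \<Theta>' \<theta>\<^sub>0 r(1) \<Theta>0 by (simp_all add: field_simps)
    then show "?\<psi> t = shift_curve c (std_circle r a) (\<phi> t)"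
      by (simp add: vec_eq_iff forall_3 shift_curve_def std_circle_def z[OF t] x_def y_def
          \<Theta>_def del: psi.simps)
  qed
  then show ?thesis
    using r K c unfolding K_shift[symmetric] by blast
qed

text \<open>For an arbitrary axis, \<open>\<psi>\<^sub>k\<^sub>+\<^sub>1\<close> itself, parametrized by its arc length \<open>\<phi>\<close>, serves as the
  curve \<open>\<gamma>\<close>. As \<open>\<phi>\<close> is measured from \<open>t\<^sub>0\<close>, the parameter interval contains 0 and \<open>c = 0\<close> can
  be taken.\<close>

lemma k_slant_from_circle:
  assumes \<alpha>: "spherical_curve J \<alpha>" and slant: "k_slant k J \<alpha>"
  shows "\<exists>K \<gamma> c \<theta> \<beta>. const_speed_spherical_circle K \<gamma> \<and> c \<in> K \<and>
    is_I_iter (k + 1) (shift_interval c K) (shift_curve c \<gamma>) \<theta> \<beta> \<and>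
    reparametrization J \<alpha> (shift_interval c K) \<beta>"
proof -
  let ?\<psi> = "psi \<alpha> (Suc k)"
  note \<psi>_spherical = spherical_curve_psi[OF \<alpha>, of "Suc k"]
  note \<psi> = spherical_curveD[OF \<psi>_spherical]
  obtain u where slant_u: "k_slant_with_axis k J \<alpha> u"
    using slant by (auto simp: k_slant_def)
  then have u: "u \<noteq> 0"
    by (simp add: k_slant_with_axis_def)
  obtain a where a: "a\<^sup>2 < 1" "\<And>t. t \<in> J \<Longrightarrow> ?\<psi> t \<bullet> u = a * norm u"
    using k_slant_psi_on_circle[OF \<alpha> slant_u] by blast
  define r where "r = sqrt (1 - a\<^sup>2)"
  have r: "r > 0" "r\<^sup>2 = 1 - a\<^sup>2"
    using a(1) by (simp_all add: r_def)
  define p where "p = (a / norm u) *\<^sub>R u"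
  define C where "C = {x. (x - p) \<bullet> u = 0 \<and> dist p x = r}"
  have p_inner: "x \<bullet> p = a / norm u * (x \<bullet> u)" for x
    by (simp add: p_def)
  have p_u: "p \<bullet> u = a * norm u"
    using u by (simp add: p_def dot_square_norm power2_eq_square)
  have p_p: "p \<bullet> p = a\<^sup>2"
    using u by (simp add: p_inner p_u power2_eq_square)
  have dist_p: "(dist p x)\<^sup>2 = x \<bullet> x - 2 * (x \<bullet> p) + a\<^sup>2" for x
    unfolding dist_norm power2_norm_eq_inner
    by (simp add: inner_diff inner_commute p_p)
  have on_plane: "(x - p) \<bullet> u = 0 \<longleftrightarrow> x \<bullet> u = a * norm u" for x
    by (simp add: inner_diff_left p_u)
  have inner_p: "x \<bullet> p = a\<^sup>2" if "x \<bullet> u = a * norm u" for x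
    using u that by (simp add: p_inner power2_eq_square)
  have C_sphere: "C \<subseteq> sphere 0 1"
  proof
    fix x assume "x \<in> C"
    then have "x \<bullet> p = a\<^sup>2" "(dist p x)\<^sup>2 = r\<^sup>2"
      using inner_p by (auto simp: C_def on_plane)
    then have "x \<bullet> x = 1"
      using dist_p[of x] r(2) by simp
    then show "x \<in> sphere 0 1"
      by (simp add: norm_eq_1)
  qed
  have \<psi>_C: "?\<psi> t \<in> C" if "t \<in> J" for t
  proof -
    have "?\<psi> t \<bullet> ?\<psi> t = 1"
      using \<psi>(5)[OF that] by (simp only: norm_eq_1)
    then have "(dist p (?\<psi> t))\<^sup>2 = r\<^sup>2"
      using dist_p[of "?\<psi> t"] inner_p[OF a(2)[OF that]] r(2) by linarith
    then have "dist p (?\<psi> t) = r"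
      using r(1) by (simp add: power2_eq_iff_nonneg del: psi.simps)
    then show ?thesis
      unfolding C_def on_plane using a(2)[OF that] by blast
  qed

  obtain t\<^sub>0 where t\<^sub>0: "t\<^sub>0 \<in> J"
    using open_intervalD(4)[OF \<psi>(1)] by blast
  have "smooth_on J (\<lambda>t. norm (vderiv ?\<psi> t))"
    by (intro smooth_on_norm smooth_on_vderiv \<psi>)
  then obtain \<phi> where \<phi>: "\<phi> t\<^sub>0 = 0"
      "\<And>t. t \<in> J \<Longrightarrow> (\<phi> has_vector_derivative norm (vderiv ?\<psi> t)) (at t)" "smooth_on J \<phi>"
    using smooth_antiderivative[OF \<psi>(1) t\<^sub>0] by blast
  have vderiv_\<phi>: "vderiv \<phi> t = norm (vderiv ?\<psi> t)" if "t \<in> J" for t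
    by (rule vector_derivative_at[OF \<phi>(2)[OF that]])
  then have vderiv_\<phi>_0: "vderiv \<phi> t \<noteq> 0" if "t \<in> J" for t
    using that \<psi>(4) by (simp del: psi.simps)
  let ?\<iota> = "inv_into J \<phi>"
  define \<gamma> where "\<gamma> s = ?\<psi> (?\<iota> s)" for s
  have inv: "?\<iota> (\<phi> t) = t" if "t \<in> J" for t
    using diffeomorphism_onto_image(2)[OF \<psi>(1) \<phi>(3) vderiv_\<phi>_0] that
    by (rule bij_betw_inv_into_left)
  have \<gamma>: "spherical_curve (\<phi> ` J) \<gamma>"
    unfolding \<gamma>_def[abs_def]
    by (rule spherical_curve_reparametrize[OF \<psi>_spherical \<phi>(3) vderiv_\<phi>_0])
  have speed: "norm (vderiv \<gamma> s) = 1" if s: "s \<in> \<phi> ` J" for s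
  proof -
    have mem: "?\<iota> s \<in> J"
      using s by (rule inv_into_into)
    have "vderiv \<gamma> s = inverse (vderiv \<phi> (?\<iota> s)) *\<^sub>R vderiv ?\<psi> (?\<iota> s)"
      unfolding \<gamma>_def[abs_def]
      by (rule vector_derivative_at[OF reparametrization_inverse_derivative[OF \<psi>(1) \<phi>(3)
              vderiv_\<phi>_0 \<psi>(3) s]])
    then show ?thesis
      using \<psi>(4)[OF mem] by (simp add: vderiv_\<phi>[OF mem] del: psi.simps)
  qed
  have "const_speed_spherical_circle (\<phi> ` J) \<gamma>"
    unfolding const_speed_spherical_circle_def
  proof (intro conjI exI ballI)
    show "regular_curve (\<phi> ` J) \<gamma>"
      using \<gamma> by (simp add: spherical_curve_def)
    show "is_circle C"
      unfolding is_circle_def C_def using u r(1) by blast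
    show "\<gamma> ` \<phi> ` J \<subseteq> C"
      using \<psi>_C by (auto simp: \<gamma>_def inv simp del: psi.simps)
  qed (fact C_sphere speed)+
  moreover have zero: "0 \<in> \<phi> ` J"
    using t\<^sub>0 \<phi>(1) by force
  moreover have "\<exists>\<theta> \<beta>. is_I_iter (k + 1) (\<phi> ` J) \<gamma> \<theta> \<beta> \<and> reparametrization J \<alpha> (\<phi> ` J) \<beta>"
    by (rule iterated_I_of_psi[OF \<alpha> \<phi>(3) vderiv_\<phi>_0 refl zero \<gamma>])
      (simp_all add: \<gamma>_def inv del: psi.simps)
  moreover have "shift_interval 0 (\<phi> ` J) = \<phi> ` J" "shift_curve 0 \<gamma> = \<gamma>"
    by (simp_all add: shift_interval_def shift_curve_def)
  ultimately show ?thesis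
    by metis
qed

theorem corollary3p2:
  shows "(\<forall>k::nat. \<exists>J \<alpha>. spherical_curve J \<alpha> \<and> k_slant k J \<alpha>)
    \<and> (\<forall>(k::nat) J \<alpha>. spherical_curve J \<alpha> \<and> k_slant_with_axis k J \<alpha> (vector [0, 0, 1]) \<longrightarrow>
         (\<exists>r a K c \<theta> \<beta>. r > 0 \<and> a\<^sup>2 + r\<^sup>2 = 1 \<and> open_interval K \<and> c \<in> K \<and>
            is_I_iter (k + 1) (shift_interval c K) (shift_curve c (std_circle r a)) \<theta> \<beta> \<and>
            reparametrization J \<alpha> (shift_interval c K) \<beta>))
    \<and> (\<forall>(k::nat) J \<alpha>. spherical_curve J \<alpha> \<and> k_slant k J \<alpha> \<longrightarrow>
         (\<exists>K \<gamma> c \<theta> \<beta>. const_speed_spherical_circle K \<gamma> \<and> c \<in> K \<and>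
            is_I_iter (k + 1) (shift_interval c K) (shift_curve c \<gamma>) \<theta> \<beta> \<and>
            reparametrization J \<alpha> (shift_interval c K) \<beta>))"
  by (intro conjI allI impI exists_spherical_k_slant k_slant_vertical_axis_from_std_circle
      k_slant_from_circle) auto

end
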